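(* Let $\mathcal{X}$ be a standard Borel space, let $Q_0$ be a probability distribution on $\mathcal{X}$, let $T:\mathcal{X}\to\mathbb{R}$ be a (measurable) function, let $P(\cdot\mid x)$ be a probability kernel from $\mathcal{X}$ to $\mathcal{X}$, and let $\epsilon\ge 0$. Let $X\sim Q_0$. For a finite integer $m\ge1$, let $X_1,\dots,X_m$ be, conditionally on $X$, i.i.d. draws from $P(\cdot\mid X)$ and let \[p_m=\frac{1+\sum_{i=1}^m \mathbf{1}\{T(X_i)\ge T(X)\}}{m+1};\] for $m=\infty$, let \[p_\infty=\mathbb{P}\{T(X')\ge T(X)\mid X\},\quad\text{where } X'\mid X\sim P(\cdot\mid X).\] (i) Suppose there is a (measurable) function $f$ on $\mathcal{X}$ such that, if $X\sim Q_0$, $X'\mid X\sim P(\cdot\mid X)$ and $X''\mid X\sim Q_0(\cdot\mid f(X))$, then \[\mathrm{d}_{\mathrm{TV}}\big((X,X'),(X,X'')\big)\le\epsilon.\] Then, for every finite $m\ge1$ and for $m=\infty$, \[\mathbb{P}\{p_m\le\alpha\}\le\alpha+\sqrt{2\epsilon}\quad\text{for all }\alpha\in[0,1].\] (ii) Suppose instead the stronger condition that there is a (measurable) function $f$ on $\mathcal{X}$ such that, if $X\sim Q_0$, then \[\mathrm{d}_{\mathrm{TV}}\big(P(\cdot\mid X),Q_0(\cdot\mid f(X))\big)\le\epsilon\quad\text{almost surely}.\] Then, for every finite $m\ge1$ and for $m=\infty$, \[\mathbb{P}\{p_m\le\alpha\}\le\alpha+\epsilon\quad\text{for all }\alpha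\in[0,1].\]
   Context: $\mathrm{d}_{\mathrm{TV}}$ denotes total variation distance, $\mathrm{d}_{\mathrm{TV}}(\mu,\nu)=\sup_A|\mu(A)-\nu(A)|$; applied to random variables it means the distance between their distributions. $f$ takes values in an arbitrary measurable space, and $Q_0(\cdot\mid f(X))$ denotes the (regular) conditional distribution of $X$ given $f(X)$ when $X\sim Q_0$. *)

theory Defs
  imports "HOL-Probability.Probability"
begin

definition standard_borel :: "'a measure \<Rightarrow> bool" where
  "standard_borel M \<longleftrightarrow>
     (\<exists>S. topspace S = space M \<and> completely_metrizable_space S \<and> second_countable S \<and>
          sets M = sigma_sets (space M) {U. openin S U})"

text \<open>Only meaningful for probability measures \<open>\<mu>\<close> and \<open>\<nu>\<close> on the same \<open>\<sigma>\<close>-algebra,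
  where the supremum ranges over a nonempty set bounded by 1.\<close>

definition tv_dist :: "'a measure \<Rightarrow> 'a measure \<Rightarrow> real" where
  "tv_dist \<mu> \<nu> = (SUP A\<in>sets \<mu>. \<bar>measure \<mu> A - measure \<nu> A\<bar>)"

text \<open>The law of \<open>(X, Y)\<close> when \<open>X\<close> has law \<open>\<mu>\<close> and \<open>Y\<close> is drawn from \<open>\<kappa> X\<close>
  given \<open>X\<close>.\<close>

definition kernel_joint :: "'a measure \<Rightarrow> 'b measure \<Rightarrow> ('a \<Rightarrow> 'b measure) \<Rightarrow> ('a \<times> 'b) measure"
  where "kernel_joint \<mu> N \<kappa> = \<mu> \<bind> (\<lambda>x. distr (\<kappa> x) (\<mu> \<Otimes>\<^sub>M N) (Pair x))"

lemma emeasure_kernel_joint_Times: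
  assumes "space \<mu> \<noteq> {}" "\<kappa> \<in> \<mu> \<rightarrow>\<^sub>M prob_algebra N" "A \<in> sets \<mu>" "B \<in> sets N"
  shows "emeasure (kernel_joint \<mu> N \<kappa>) (A \<times> B) = (\<integral>\<^sup>+x. indicator A x * emeasure (\<kappa> x) B \<partial>\<mu>)"
proof -
  have *: "(\<lambda>x. distr (\<kappa> x) (\<mu> \<Otimes>\<^sub>M N) (Pair x)) \<in> \<mu> \<rightarrow>\<^sub>M subprob_algebra (\<mu> \<Otimes>\<^sub>M N)"
    using measurable_prob_algebraD[OF assms(2)] by (intro measurable_distr2) auto
  show ?thesis
    unfolding kernel_joint_def
  proof (subst emeasure_bind[OF assms(1) *])
    show "A \<times> B \<in> sets (\<mu> \<Otimes>\<^sub>M N)" using assms by auto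
    show "(\<integral>\<^sup>+x. emeasure (distr (\<kappa> x) (\<mu> \<Otimes>\<^sub>M N) (Pair x)) (A \<times> B) \<partial>\<mu>) =
      (\<integral>\<^sup>+x. indicator A x * emeasure (\<kappa> x) B \<partial>\<mu>)"
    proof (rule nn_integral_cong)
      fix x assume x: "x \<in> space \<mu>"
      have s[measurable_cong]: "sets (\<kappa> x) = sets N"
        using measurable_space[OF assms(2) x] by (simp add: space_prob_algebra)
      have "Pair x \<in> \<kappa> x \<rightarrow>\<^sub>M \<mu> \<Otimes>\<^sub>M N"
        using x by measurable
      moreover have "Pair x -` (A \<times> B) \<inter> space (\<kappa> x) = (if x \<in> A then B else {})"
        using sets.sets_into_space[OF assms(4)] sets_eq_imp_space_eq[OF s] by auto
      ultimately show "emeasure (distr (\<kappa> x) (\<mu> \<Otimes>\<^sub>M N) (Pair x)) (A \<times> B) =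
          indicator A x * emeasure (\<kappa> x) B"
        using assms by (simp add: emeasure_distr)
    qed
  qed
qed

text \<open>\<open>\<kappa>\<close> is a (version of the) regular conditional distribution on \<open>\<Omega>\<close> of the \<open>N\<close>-valued
  random variable \<open>Y\<close> given the \<open>M\<close>-valued random variable \<open>X\<close>.\<close>

definition has_cond_distr ::
  "'w measure \<Rightarrow> 'a measure \<Rightarrow> ('w \<Rightarrow> 'a) \<Rightarrow> 'b measure \<Rightarrow> ('w \<Rightarrow> 'b) \<Rightarrow> ('a \<Rightarrow> 'b measure) \<Rightarrow> bool"
  where
  "has_cond_distr \<Omega> M X N Y \<kappa> \<longleftrightarrow>
     X \<in> \<Omega> \<rightarrow>\<^sub>M M \<and> Y \<in> \<Omega> \<rightarrow>\<^sub>M N \<and> \<kappa> \<in> M \<rightarrow>\<^sub>M prob_algebra N \<and>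
     distr \<Omega> (M \<Otimes>\<^sub>M N) (\<lambda>\<omega>. (X \<omega>, Y \<omega>)) = kernel_joint (distr \<Omega> M X) N \<kappa>"

definition cond_iid_draws ::
  "'w measure \<Rightarrow> 'a measure \<Rightarrow> ('w \<Rightarrow> 'a) \<Rightarrow> ('a \<Rightarrow> 'a measure) \<Rightarrow> nat \<Rightarrow> (nat \<Rightarrow> 'w \<Rightarrow> 'a) \<Rightarrow> bool"
  where
  "cond_iid_draws \<Omega> M X P m Xs \<longleftrightarrow>
     has_cond_distr \<Omega> M X (\<Pi>\<^sub>M i\<in>{1..m}. M) (\<lambda>\<omega>. \<lambda>i\<in>{1..m}. Xs i \<omega>) (\<lambda>x. \<Pi>\<^sub>M i\<in>{1..m}. P x)"

definition p_fin :: "('a \<Rightarrow> real) \<Rightarrow> ('w \<Rightarrow> 'a) \<Rightarrow> nat \<Rightarrow> (nat \<Rightarrow> 'w \<Rightarrow> 'a) \<Rightarrow> 'w \<Rightarrow> real" where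
  "p_fin T X m Xs \<omega> = (1 + (\<Sum>i=1..m. of_bool (T (Xs i \<omega>) \<ge> T (X \<omega>)))) / (real m + 1)"

text \<open>The conditional probability of the event \<open>T X' \<ge> T X\<close> given the \<open>\<sigma>\<close>-algebra generated by \<open>X\<close>.\<close>

definition p_inf ::
  "'w measure \<Rightarrow> 'a measure \<Rightarrow> ('a \<Rightarrow> real) \<Rightarrow> ('w \<Rightarrow> 'a) \<Rightarrow> ('w \<Rightarrow> 'a) \<Rightarrow> 'w \<Rightarrow> real" where
  "p_inf \<Omega> M T X X' =
     real_cond_exp \<Omega> (vimage_algebra (space \<Omega>) X M)
       (indicat_real {\<omega> \<in> space \<Omega>. T (X' \<omega>) \<ge> T (X \<omega>)})"

end

theory Submission imports Defs begin

text \<open>Let \<open>p(x) = P(T \<ge> T(x) | x)\<close> and let \<open>q(x)\<close> be the same tail probability under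
  \<open>Q\<^sub>0(\<cdot> | f(x))\<close>. Given \<open>f(X)\<close>, the point \<open>X\<close> is itself a draw from \<open>Q\<^sub>0(\<cdot> | f(X))\<close>, so \<open>q(X)\<close> is
  superuniform. Since \<open>p\<^sub>\<infinity> = p(X)\<close> almost surely, the infinite case is about passing from \<open>q\<close> to
  \<open>p\<close>: almost surely \<open>q \<le> p + \<epsilon>\<close> in (ii), while in (i) only the integral of \<open>(q - p)\<^sup>+\<close> is at most
  \<open>\<epsilon>\<close>.

  The finite case follows from the infinite one. With \<open>k + 1 = \<lfloor>\<alpha>(m + 1)\<rfloor>\<close>, the event \<open>p\<^sub>m \<le> \<alpha>\<close> has
  conditional probability \<open>F(p(X))\<close>, where \<open>F(u)\<close> is the probability that a binomial \<open>(m, u)\<close>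
  variable is at most \<open>k\<close>. As \<open>-F'\<close> is the density of a Beta \<open>(k + 1, m - k)\<close> law, whose mean is
  \<open>(k + 1)/(m + 1) \<le> \<alpha>\<close>, integrating \<open>Prob{p(X) \<le> u} \<le> u + \<delta>\<close> against it bounds the expectation of
  \<open>F(p(X))\<close> by \<open>\<alpha> + \<delta>\<close>.\<close>

text \<open>The tail is closed, as in both p-values, so ties count; this keeps the tail evaluated at
  a random draw superuniform even when the law of \<open>T\<close> has atoms.\<close>

definition upper_tail :: "'a measure \<Rightarrow> ('a \<Rightarrow> real) \<Rightarrow> real \<Rightarrow> real" where
  "upper_tail \<mu> T t = measure \<mu> {y \<in> space \<mu>. t \<le> T y}"

text \<open>Terms with \<open>j > m\<close> vanish through the binomial coefficient, so truncation
  in \<open>m - j\<close> is harmless. The convention \<open>0 ^ 0 = 1\<close> gives the right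
  values at \<open>p = 0\<close> and \<open>p = 1\<close>.\<close>

definition binomial_cdf :: "nat \<Rightarrow> nat \<Rightarrow> real \<Rightarrow> real" where
  "binomial_cdf m k p = (\<Sum>j\<le>k. real (m choose j) * p ^ j * (1 - p) ^ (m - j))"

subsection \<open>Kernels and upper tails\<close>

lemma prob_kernelD:
  assumes "\<kappa> \<in> M \<rightarrow>\<^sub>M prob_algebra N" "x \<in> space M"
  shows "prob_space (\<kappa> x)" "sets (\<kappa> x) = sets N" "space (\<kappa> x) = space N"
  using measurable_space[OF assms] sets_eq_imp_space_eq[of "\<kappa> x" N]
  by (auto simp: space_prob_algebra)

lemma measurable_Pair_kernel:
  assumes "\<kappa> \<in> \<mu> \<rightarrow>\<^sub>M prob_algebra N" "x \<in> space \<mu>"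
  shows "Pair x \<in> \<kappa> x \<rightarrow>\<^sub>M \<mu> \<Otimes>\<^sub>M N"
  using assms(2) by (simp add: measurable_cong_sets[OF prob_kernelD(2)[OF assms] refl])

lemma kernel_joint_kernel:
  assumes "\<kappa> \<in> \<mu> \<rightarrow>\<^sub>M prob_algebra N"
  shows "(\<lambda>x. distr (\<kappa> x) (\<mu> \<Otimes>\<^sub>M N) (Pair x)) \<in> \<mu> \<rightarrow>\<^sub>M prob_algebra (\<mu> \<Otimes>\<^sub>M N)"
  by (intro measurable_prob_algebraI measurable_distr2[OF _ measurable_prob_algebraD[OF assms]]
        prob_space.prob_space_distr prob_kernelD(1)[OF assms] measurable_Pair_kernel[OF assms])
     simp_all

lemma sets_kernel_joint:
  assumes "prob_space \<mu>" "\<kappa> \<in> \<mu> \<rightarrow>\<^sub>M prob_algebra N"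
  shows "sets (kernel_joint \<mu> N \<kappa>) = sets (\<mu> \<Otimes>\<^sub>M N)"
  unfolding kernel_joint_def
  using measurable_prob_algebraD[OF kernel_joint_kernel[OF assms(2)]] prob_space.not_empty[OF assms(1)]
  by (intro sets_bind) (auto simp: sets_kernel)

lemma prob_space_kernel_joint:
  assumes "prob_space \<mu>" "\<kappa> \<in> \<mu> \<rightarrow>\<^sub>M prob_algebra N"
  shows "prob_space (kernel_joint \<mu> N \<kappa>)"
  unfolding kernel_joint_def
  by (rule prob_space_bind'[OF _ kernel_joint_kernel[OF assms(2)]])
     (simp add: space_prob_algebra assms)

text \<open>Slicing is needed for every measurable \<open>B\<close>, because events comparing
  \<open>T\<close> at the two coordinates are not rectangles.\<close>

lemma emeasure_kernel_joint:
  assumes "prob_space \<mu>" "\<kappa> \<in> \<mu> \<rightarrow>\<^sub>M prob_algebra N" and B: "B \<in> sets (\<mu> \<Otimes>\<^sub>M N)"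
  shows "emeasure (kernel_joint \<mu> N \<kappa>) B = (\<integral>\<^sup>+x. emeasure (\<kappa> x) {y \<in> space N. (x, y) \<in> B} \<partial>\<mu>)"
  unfolding kernel_joint_def
proof (subst emeasure_bind[OF _ measurable_prob_algebraD[OF kernel_joint_kernel[OF assms(2)]] B])
  show "space \<mu> \<noteq> {}" using assms(1) by (rule prob_space.not_empty)
  show "(\<integral>\<^sup>+x. emeasure (distr (\<kappa> x) (\<mu> \<Otimes>\<^sub>M N) (Pair x)) B \<partial>\<mu>) =
      (\<integral>\<^sup>+x. emeasure (\<kappa> x) {y \<in> space N. (x, y) \<in> B} \<partial>\<mu>)"
  proof (rule nn_integral_cong)
    fix x assume x: "x \<in> space \<mu>"
    note k = prob_kernelD[OF assms(2) x]
    have "Pair x \<in> \<kappa> x \<rightarrow>\<^sub>M \<mu> \<Otimes>\<^sub>M N"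
      using assms(2) x by (rule measurable_Pair_kernel)
    moreover have "Pair x -` B \<inter> space (\<kappa> x) = {y \<in> space N. (x, y) \<in> B}"
      by (auto simp: k)
    ultimately show "emeasure (distr (\<kappa> x) (\<mu> \<Otimes>\<^sub>M N) (Pair x)) B =
        emeasure (\<kappa> x) {y \<in> space N. (x, y) \<in> B}"
      using B by (simp add: emeasure_distr)
  qed
qed

text \<open>Turns a joint event into an average of conditional probabilities. It serves both for
  \<open>X\<close> given \<open>f(X)\<close> and for the vector of Monte Carlo draws given
  \<open>X\<close>.\<close>

lemma emeasure_has_cond_distr:
  assumes "prob_space \<Omega>" and c: "has_cond_distr \<Omega> M X N Y \<kappa>" and B: "B \<in> sets (M \<Otimes>\<^sub>M N)"
  shows "emeasure \<Omega> {\<omega> \<in> space \<Omega>. (X \<omega>, Y \<omega>) \<in> B} =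
    (\<integral>\<^sup>+x. emeasure (\<kappa> x) {y \<in> space N. (x, y) \<in> B} \<partial>distr \<Omega> M X)"
proof -
  have m[measurable]: "X \<in> \<Omega> \<rightarrow>\<^sub>M M" "Y \<in> \<Omega> \<rightarrow>\<^sub>M N" and k: "\<kappa> \<in> M \<rightarrow>\<^sub>M prob_algebra N"
    and d: "distr \<Omega> (M \<Otimes>\<^sub>M N) (\<lambda>\<omega>. (X \<omega>, Y \<omega>)) = kernel_joint (distr \<Omega> M X) N \<kappa>"
    using c by (auto simp: has_cond_distr_def)
  have "{\<omega> \<in> space \<Omega>. (X \<omega>, Y \<omega>) \<in> B} = (\<lambda>\<omega>. (X \<omega>, Y \<omega>)) -` B \<inter> space \<Omega>" by auto
  hence "emeasure \<Omega> {\<omega> \<in> space \<Omega>. (X \<omega>, Y \<omega>) \<in> B} =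
      emeasure (distr \<Omega> (M \<Otimes>\<^sub>M N) (\<lambda>\<omega>. (X \<omega>, Y \<omega>))) B"
    using B by (simp add: emeasure_distr)
  also have "\<dots> = (\<integral>\<^sup>+x. emeasure (\<kappa> x) {y \<in> space N. (x, y) \<in> B} \<partial>distr \<Omega> M X)"
    unfolding d
  proof (rule emeasure_kernel_joint)
    show "prob_space (distr \<Omega> M X)" using assms(1) m(1) by (rule prob_space.prob_space_distr)
    show "\<kappa> \<in> distr \<Omega> M X \<rightarrow>\<^sub>M prob_algebra N" using k by simp
    show "B \<in> sets (distr \<Omega> M X \<Otimes>\<^sub>M N)" using B by (simp cong: sets_pair_measure_cong)
  qed
  finally show ?thesis .
qed

text \<open>The threshold moves with \<open>x\<close>, so the tail events are seen as the sections
  of one measurable subset of the product space.\<close>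

lemma upper_tail_measurable:
  assumes k: "\<kappa> \<in> M \<rightarrow>\<^sub>M prob_algebra N" and [measurable]: "T \<in> borel_measurable N" "t \<in> borel_measurable M"
  shows "(\<lambda>x. upper_tail (\<kappa> x) T (t x)) \<in> borel_measurable M"
proof -
  have "(SIGMA x:space M. {y \<in> space N. t x \<le> T y}) = {z \<in> space (M \<Otimes>\<^sub>M N). t (fst z) \<le> T (snd z)}"
    by (auto simp: space_pair_measure)
  also have "\<dots> \<in> sets (M \<Otimes>\<^sub>M N)" by measurable
  finally have "(\<lambda>x. measure (\<kappa> x) {y \<in> space N. t x \<le> T y}) \<in> borel_measurable M"
    by (rule measure_measurable_subprob_algebra2) (rule measurable_prob_algebraD[OF k])
  thus ?thesis
    by (rule measurable_cong[THEN iffD1, rotated]) (simp add: upper_tail_def prob_kernelD[OF k])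
qed

section \<open>Superuniformity of upper tails\<close>

lemma upper_tail_bounds:
  assumes "prob_space \<mu>"
  shows "0 \<le> upper_tail \<mu> T t" "upper_tail \<mu> T t \<le> 1"
  unfolding upper_tail_def using prob_space.prob_le_1[OF assms] by auto

text \<open>Every compact subset of the set of \<open>t\<close> with \<open>\<nu> {t..} \<le> a\<close> lies in \<open>{c..}\<close>, where \<open>c\<close> is its
  least element; inner regularity then bounds the measure of the whole set.\<close>

lemma emeasure_upper_tail_le_real:
  fixes \<nu> :: "real measure"
  assumes "prob_space \<nu>" and s: "sets \<nu> = sets borel" and "a \<ge> 0"
  shows "emeasure \<nu> {t. measure \<nu> {t..} \<le> a} \<le> ennreal a"
proof -
  interpret prob_space \<nu> by fact
  define S where "S = {t. measure \<nu> {t..} \<le> a}"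
  \<comment> \<open>The tail is antitone. Negation makes it monotone, hence Borel measurable, and a
    second negation recovers it.\<close>
  have "mono (\<lambda>t. - measure \<nu> {t..})"
    by (intro monoI) (auto intro!: finite_measure_mono simp: s)
  hence "(\<lambda>t. - (- measure \<nu> {t..})) \<in> borel_measurable borel"
    by (intro borel_measurable_uminus borel_measurable_mono)
  hence [measurable]: "(\<lambda>t. measure \<nu> {t..}) \<in> borel_measurable borel" by simp
  have S: "S \<in> sets borel" unfolding S_def by measurable
  have "emeasure \<nu> S = (SUP K \<in> {K. K \<subseteq> S \<and> compact K}. emeasure \<nu> K)"
    using s S by (intro inner_regular) auto
  also have "\<dots> \<le> ennreal a"
  proof (rule SUP_least, safe)
    fix K assume K: "K \<subseteq> S" "compact K"
    show "emeasure \<nu> K \<le> ennreal a"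
    proof (cases "K = {}")
      case False
      then obtain c where c: "c \<in> K" "\<And>t. t \<in> K \<Longrightarrow> c \<le> t"
        using compact_attains_inf[OF K(2)] by auto
      have "emeasure \<nu> K \<le> emeasure \<nu> {c..}" using c(2) by (intro emeasure_mono) (auto simp: s)
      also have "\<dots> \<le> ennreal a" using c(1) K(1)
        by (auto simp: emeasure_eq_measure S_def intro!: ennreal_leI)
      finally show ?thesis .
    qed simp
  qed
  finally show ?thesis by (simp add: S_def)
qed

text \<open>Pushing \<open>\<mu>\<close> forward along \<open>T\<close> preserves the tails, so the
  question moves to the real line, where inner regularity by compact sets is available.\<close>

lemma emeasure_upper_tail_le:
  assumes "prob_space \<mu>" and [measurable]: "T \<in> borel_measurable \<mu>" and "a \<ge> 0"
  shows "emeasure \<mu> {x \<in> space \<mu>. upper_tail \<mu> T (T x) \<le> a} \<le> ennreal a"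
proof -
  interpret prob_space \<mu> by fact
  let ?\<nu> = "distr \<mu> borel T"
  have t: "measure ?\<nu> {t..} = upper_tail \<mu> T t" for t
    by (auto simp: measure_distr upper_tail_def intro!: arg_cong[of _ _ prob])
  have "mono (\<lambda>t. - upper_tail \<mu> T t)"
    by (intro monoI) (auto intro!: finite_measure_mono simp: upper_tail_def)
  hence "(\<lambda>t. - (- upper_tail \<mu> T t)) \<in> borel_measurable borel"
    by (intro borel_measurable_uminus borel_measurable_mono)
  hence [measurable]: "upper_tail \<mu> T \<in> borel_measurable borel" by simp
  have "{x \<in> space \<mu>. upper_tail \<mu> T (T x) \<le> a} = T -` {t. measure ?\<nu> {t..} \<le> a} \<inter> space \<mu>"
    by (auto simp: t)
  moreover have "{t. upper_tail \<mu> T t \<le> a} \<in> sets borel" by measurable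
  ultimately have "emeasure \<mu> {x \<in> space \<mu>. upper_tail \<mu> T (T x) \<le> a} =
      emeasure ?\<nu> {t. measure ?\<nu> {t..} \<le> a}"
    by (simp add: emeasure_distr t)
  also have "\<dots> \<le> ennreal a"
    using assms by (intro emeasure_upper_tail_le_real prob_space_distr) auto
  finally show ?thesis .
qed

text \<open>Given \<open>Y = y\<close>, the point \<open>X\<close> is a draw from
  \<open>K y\<close>, and the unconditional bound \<open>a\<close> is the same for every
  \<open>y\<close>; averaging over \<open>y\<close> preserves it.\<close>

lemma emeasure_cond_upper_tail_le:
  assumes "prob_space \<Omega>" and [measurable]: "T \<in> borel_measurable M"
    and c: "has_cond_distr \<Omega> N Y M X K" and "a \<ge> 0"
  shows "emeasure \<Omega> {\<omega> \<in> space \<Omega>. upper_tail (K (Y \<omega>)) T (T (X \<omega>)) \<le> a} \<le> ennreal a"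
proof -
  have m[measurable]: "X \<in> \<Omega> \<rightarrow>\<^sub>M M" "Y \<in> \<Omega> \<rightarrow>\<^sub>M N" and k: "K \<in> N \<rightarrow>\<^sub>M prob_algebra M"
    using c by (auto simp: has_cond_distr_def)
  interpret D: prob_space "distr \<Omega> N Y" using assms(1) m(2) by (rule prob_space.prob_space_distr)
  define B where "B = {z \<in> space (N \<Otimes>\<^sub>M M). upper_tail (K (fst z)) T (T (snd z)) \<le> a}"
  have [measurable]: "(\<lambda>z. upper_tail (K (fst z)) T (T (snd z))) \<in> borel_measurable (N \<Otimes>\<^sub>M M)"
    by (rule upper_tail_measurable) (auto intro!: measurable_compose[OF measurable_fst k])
  have B: "B \<in> sets (N \<Otimes>\<^sub>M M)" unfolding B_def by measurable
  have "{\<omega> \<in> space \<Omega>. upper_tail (K (Y \<omega>)) T (T (X \<omega>)) \<le> a} = {\<omega> \<in> space \<Omega>. (Y \<omega>, X \<omega>) \<in> B}"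
    using measurable_space[OF m(1)] measurable_space[OF m(2)] by (auto simp: B_def space_pair_measure)
  hence "emeasure \<Omega> {\<omega> \<in> space \<Omega>. upper_tail (K (Y \<omega>)) T (T (X \<omega>)) \<le> a} =
      (\<integral>\<^sup>+y. emeasure (K y) {x \<in> space M. (y, x) \<in> B} \<partial>distr \<Omega> N Y)"
    using emeasure_has_cond_distr[OF assms(1) c B] by simp
  also have "\<dots> \<le> (\<integral>\<^sup>+y. ennreal a \<partial>distr \<Omega> N Y)"
  proof (rule nn_integral_mono)
    fix y assume "y \<in> space (distr \<Omega> N Y)"
    hence y: "y \<in> space N" by simp
    note ky = prob_kernelD[OF k y]
    have "{x \<in> space M. (y, x) \<in> B} = {x \<in> space (K y). upper_tail (K y) T (T x) \<le> a}"
      using y by (auto simp: B_def space_pair_measure ky)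
    thus "emeasure (K y) {x \<in> space M. (y, x) \<in> B} \<le> ennreal a"
      using emeasure_upper_tail_le[OF ky(1), of T a] \<open>a \<ge> 0\<close>
      by (simp add: measurable_cong_sets[OF ky(2) refl])
  qed
  also have "\<dots> = ennreal a" by (simp add: D.emeasure_space_1 del: space_distr)
  finally show ?thesis .
qed

subsection \<open>The binomial distribution function\<close>

text \<open>The derivatives of successive terms telescope: the term added in the induction on
  \<open>k\<close> cancels the previous derivative and leaves minus the Beta density with the next
  parameter.\<close>

lemma DERIV_binomial_cdf:
  assumes "k \<le> n"
  shows "(binomial_cdf (Suc n) k has_real_derivative
    - (real (Suc n) * real (n choose k) * p ^ k * (1 - p) ^ (n - k))) (at p)"
  using assms
proof (induction k)
  case 0
  have "((\<lambda>p. (1 - p) ^ Suc n) has_real_derivative - (real (Suc n) * (1 - p) ^ n)) (at p)"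
    by (rule derivative_eq_intros refl)+ simp
  moreover have "binomial_cdf (Suc n) 0 = (\<lambda>p. (1 - p) ^ Suc n)" by (simp add: binomial_cdf_def fun_eq_iff)
  ultimately show ?case by (simp del: power_Suc)
next
  case (Suc k)
  define r where "r = n - Suc k"
  have n: "n - k = Suc r" "Suc n - Suc k = Suc r" "n - Suc k = r" using Suc.prems by (auto simp: r_def)
  \<comment> \<open>Two absorption identities: \<open>e\<close> makes the old derivative cancel, and
    \<open>e2\<close> gives the coefficient of the piece that remains.\<close>
  have e: "real (Suc n choose Suc k) * real (Suc k) = real (Suc n) * real (n choose k)"
    by (metis Suc_times_binomial_eq of_nat_mult mult.commute)
  have e2: "real (Suc n choose Suc k) * real (Suc r) = real (Suc n) * real (n choose Suc k)"
    using binomial_absorb_comp[of "Suc n" "Suc k"] n(2)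
    by (metis diff_Suc_1 of_nat_mult mult.commute)
  have "binomial_cdf (Suc n) (Suc k) = (\<lambda>p. binomial_cdf (Suc n) k p +
      real (Suc n choose Suc k) * p ^ Suc k * (1 - p) ^ Suc r)"
    by (auto simp: binomial_cdf_def n)
  moreover have "((\<lambda>p. binomial_cdf (Suc n) k p +
      real (Suc n choose Suc k) * p ^ Suc k * (1 - p) ^ Suc r) has_real_derivative
     (- (real (Suc n) * real (n choose k) * p ^ k * (1 - p) ^ Suc r) +
      ((real (Suc n choose Suc k) * (real (Suc k) * p ^ k)) * (1 - p) ^ Suc r
       - (real (Suc n choose Suc k) * p ^ Suc k) * (real (Suc r) * (1 - p) ^ r)))) (at p)"
    using Suc.IH Suc.prems
    by (auto intro!: derivative_eq_intros simp: n simp del: power_Suc of_nat_Suc binomial_Suc_Suc)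
  moreover have "(- (real (Suc n) * real (n choose k) * p ^ k * (1 - p) ^ Suc r) +
      ((real (Suc n choose Suc k) * (real (Suc k) * p ^ k)) * (1 - p) ^ Suc r
       - (real (Suc n choose Suc k) * p ^ Suc k) * (real (Suc r) * (1 - p) ^ r))) =
      - (real (Suc n) * real (n choose Suc k) * p ^ Suc k * (1 - p) ^ r)"
    unfolding e[symmetric] e2[symmetric]
    by (simp only: mult.assoc mult.left_commute mult.commute)
  ultimately show ?case by (simp only: n)
qed

lemma binomial_cdf_0: "binomial_cdf m k 0 = 1"
proof -
  have "binomial_cdf m k 0 = (\<Sum>j\<le>k. if j = 0 then 1 else 0)"
    unfolding binomial_cdf_def by (intro sum.cong) auto
  thus ?thesis by simp
qed

lemma binomial_cdf_1: "k < m \<Longrightarrow> binomial_cdf m k 1 = 0"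
  unfolding binomial_cdf_def by (intro sum.neutral) auto

text \<open>By the fundamental theorem of calculus, since the distribution function vanishes at 1
  when \<open>k < Suc n\<close>. Its value at \<open>z\<close> is thus the Beta mass above
  \<open>z\<close>.\<close>

lemma nn_integral_binomial_density:
  assumes "k \<le> n" "0 \<le> z" "z \<le> 1"
  shows "(\<integral>\<^sup>+u. ennreal (real (Suc n) * real (n choose k) * u ^ k * (1 - u) ^ (n - k)) *
    indicator {z..1} u \<partial>lborel) = ennreal (binomial_cdf (Suc n) k z)"
proof -
  have "(\<integral>\<^sup>+u. ennreal (real (Suc n) * real (n choose k) * u ^ k * (1 - u) ^ (n - k)) *
      indicator {z..1} u \<partial>lborel) = ennreal ((- binomial_cdf (Suc n) k 1) - (- binomial_cdf (Suc n) k z))"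
    using assms
    by (intro nn_integral_FTC_Icc) (auto intro!: derivative_eq_intros DERIV_binomial_cdf)
  thus ?thesis using binomial_cdf_1[of k "Suc n"] assms by simp
qed

text \<open>The Beta identity \<open>u * beta(k+1, n-k+1) = (k+1)/(n+2) * beta(k+2, n-k+1)\<close> for normalised densities.\<close>

lemma nn_integral_binomial_density_mean:
  assumes "k \<le> n"
  shows "(\<integral>\<^sup>+u. ennreal (real (Suc n) * real (n choose k) * u ^ k * (1 - u) ^ (n - k) * u) *
    indicator {0..1} u \<partial>lborel) = ennreal ((real k + 1) / (real n + 2))"
proof -
  have e: "real (Suc (Suc n)) * real (Suc n choose Suc k) * real (Suc k) =
      real (Suc (Suc n)) * (real (Suc n) * real (n choose k))"
    by (metis Suc_times_binomial_eq of_nat_mult mult.commute mult.assoc)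
  have *: "real (Suc n) * real (n choose k) * u ^ k * (1 - u) ^ (n - k) * u =
      ((real k + 1) / (real n + 2)) *
      (real (Suc (Suc n)) * real (Suc n choose Suc k) * u ^ Suc k * (1 - u) ^ (Suc n - Suc k))" for u
  proof -
    have "((real k + 1) / (real n + 2)) *
      (real (Suc (Suc n)) * real (Suc n choose Suc k) * u ^ Suc k * (1 - u) ^ (Suc n - Suc k))
      = (real (Suc (Suc n)) * real (Suc n choose Suc k) * real (Suc k)) / (real n + 2) * (u ^ Suc k * (1 - u) ^ (n - k))"
      by (simp add: field_simps del: binomial_Suc_Suc)
    also have "\<dots> = real (Suc n) * real (n choose k) * (u ^ Suc k * (1 - u) ^ (n - k))"
      unfolding e by (simp add: field_simps)
    finally show ?thesis by simp
  qed
  have c0: "0 \<le> (real k + 1) / (real n + 2)" by simp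
  have "(\<integral>\<^sup>+u. ennreal (real (Suc n) * real (n choose k) * u ^ k * (1 - u) ^ (n - k) * u) *
      indicator {0..1} u \<partial>lborel) = ennreal ((real k + 1) / (real n + 2)) *
      (\<integral>\<^sup>+u. ennreal (real (Suc (Suc n)) * real (Suc n choose Suc k) * u ^ Suc k * (1 - u) ^ (Suc n - Suc k)) *
      indicator {0..1} u \<partial>lborel)"
    unfolding * ennreal_mult'[OF c0] mult.assoc[of "ennreal ((real k + 1) / (real n + 2))"]
    by (rule nn_integral_cmult) measurable
  also have "\<dots> = ennreal ((real k + 1) / (real n + 2))"
    using assms by (subst nn_integral_binomial_density) (auto simp: binomial_cdf_0)
  finally show ?thesis .
qed

section \<open>Averaging the binomial distribution function\<close>

text \<open>Tonelli: for \<open>u\<close> in \<open>{a..b}\<close>, the inner interval only records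
  whether \<open>Z x \<le> u\<close>, so after the swap the assumed bound applies at each
  \<open>u\<close>. It is used with a Beta density on \<open>{0..1}\<close> and with the constant 1
  on \<open>{a..a + s}\<close>.\<close>

lemma nn_integral_layer_le:
  fixes Z :: "'a \<Rightarrow> real" and g :: "real \<Rightarrow> real"
  assumes "prob_space \<mu>" and [measurable]: "Z \<in> borel_measurable \<mu>" "g \<in> borel_measurable borel"
    and g0: "\<And>u. u \<in> {a..b} \<Longrightarrow> 0 \<le> g u"
    and le: "\<And>u. u \<in> {a..b} \<Longrightarrow> emeasure \<mu> {x \<in> space \<mu>. Z x \<le> u} \<le> ennreal (u + \<delta>)"
  shows "(\<integral>\<^sup>+x. (\<integral>\<^sup>+u. ennreal (g u) * indicator {max a (Z x)..b} u \<partial>lborel) \<partial>\<mu>) \<le>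
    (\<integral>\<^sup>+u. ennreal (g u * (u + \<delta>)) * indicator {a..b} u \<partial>lborel)"
proof -
  interpret prob_space \<mu> by fact
  interpret pair_sigma_finite lborel \<mu> by standard
  have "(\<integral>\<^sup>+x. (\<integral>\<^sup>+u. ennreal (g u) * indicator {max a (Z x)..b} u \<partial>lborel) \<partial>\<mu>) =
      (\<integral>\<^sup>+x. (\<integral>\<^sup>+u. ennreal (g u) * indicator {a..b} u * (if Z x \<le> u then 1 else 0) \<partial>lborel) \<partial>\<mu>)"
    by (intro nn_integral_cong) (auto split: split_indicator)
  also have "\<dots> = (\<integral>\<^sup>+u. (\<integral>\<^sup>+x. ennreal (g u) * indicator {a..b} u * (if Z x \<le> u then 1 else 0) \<partial>\<mu>) \<partial>lborel)"
    by (rule Fubini') measurable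
  also have "\<dots> \<le> (\<integral>\<^sup>+u. ennreal (g u * (u + \<delta>)) * indicator {a..b} u \<partial>lborel)"
  proof (rule nn_integral_mono)
    fix u :: real
    have "(\<integral>\<^sup>+x. ennreal (g u) * indicator {a..b} u * (if Z x \<le> u then 1 else 0) \<partial>\<mu>) =
        ennreal (g u) * indicator {a..b} u * (\<integral>\<^sup>+x. indicator {x \<in> space \<mu>. Z x \<le> u} x \<partial>\<mu>)"
      by (subst nn_integral_cmult[symmetric]) (auto intro!: nn_integral_cong)
    also have "\<dots> = ennreal (g u) * indicator {a..b} u * emeasure \<mu> {x \<in> space \<mu>. Z x \<le> u}"
      by simp
    also have "\<dots> \<le> ennreal (g u * (u + \<delta>)) * indicator {a..b} u"
      using le[of u] g0[of u] by (auto simp: ennreal_mult' intro!: mult_left_mono split: split_indicator)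
    finally show "(\<integral>\<^sup>+x. ennreal (g u) * indicator {a..b} u * (if Z x \<le> u then 1 else 0) \<partial>\<mu>) \<le>
        ennreal (g u * (u + \<delta>)) * indicator {a..b} u" .
  qed
  finally show ?thesis .
qed

text \<open>Writing the distribution function as Beta mass above \<open>p x\<close> lets the layer
  bound apply. In the resulting integral of the density times \<open>u + \<delta>\<close>, the
  summand \<open>u\<close> yields the Beta mean and \<open>\<delta>\<close> meets total mass
  1.\<close>

lemma nn_integral_binomial_cdf_le:
  assumes "prob_space \<mu>" and [measurable]: "p \<in> borel_measurable \<mu>"
    and p: "\<And>x. x \<in> space \<mu> \<Longrightarrow> 0 \<le> p x" "\<And>x. x \<in> space \<mu> \<Longrightarrow> p x \<le> 1" and "0 \<le> \<delta>"
    and le: "\<And>u. u \<in> {0..1} \<Longrightarrow> emeasure \<mu> {x \<in> space \<mu>. p x \<le> u} \<le> ennreal (u + \<delta>)"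
    and "k \<le> n"
  shows "(\<integral>\<^sup>+x. ennreal (binomial_cdf (Suc n) k (p x)) \<partial>\<mu>) \<le> ennreal ((real k + 1) / (real n + 2) + \<delta>)"
proof -
  let ?g = "\<lambda>u. real (Suc n) * real (n choose k) * u ^ k * (1 - u) ^ (n - k)"
  have "(\<integral>\<^sup>+x. ennreal (binomial_cdf (Suc n) k (p x)) \<partial>\<mu>) =
      (\<integral>\<^sup>+x. (\<integral>\<^sup>+u. ennreal (?g u) * indicator {max 0 (p x)..1} u \<partial>lborel) \<partial>\<mu>)"
    using p \<open>k \<le> n\<close> by (intro nn_integral_cong) (simp add: nn_integral_binomial_density del: of_nat_Suc)
  also have "\<dots> \<le> (\<integral>\<^sup>+u. ennreal (?g u * (u + \<delta>)) * indicator {0..1} u \<partial>lborel)"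
    using assms(1) le by (intro nn_integral_layer_le) auto
  also have "\<dots> = (\<integral>\<^sup>+u. ennreal (?g u * u) * indicator {0..1} u + ennreal \<delta> * (ennreal (?g u) * indicator {0..1} u) \<partial>lborel)"
    using \<open>0 \<le> \<delta>\<close>
    by (intro nn_integral_cong)
       (auto simp: distrib_left mult.commute[of _ \<delta>] simp flip: ennreal_mult' ennreal_plus
             simp del: of_nat_Suc split: split_indicator)
  also have "\<dots> = ennreal ((real k + 1) / (real n + 2)) + ennreal \<delta> * 1"
    using \<open>k \<le> n\<close>
    by (subst nn_integral_add, measurable, subst nn_integral_cmult, measurable)
       (simp only: nn_integral_binomial_density_mean nn_integral_binomial_density binomial_cdf_0
         order.refl zero_le_one ennreal_1)
  also have "\<dots> = ennreal ((real k + 1) / (real n + 2) + \<delta>)"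
    using \<open>0 \<le> \<delta>\<close> by (simp add: ennreal_plus)
  finally show ?thesis .
qed

text \<open>The event splits by the exact set \<open>J\<close> of coordinates that hit
  \<open>A\<close>. Each piece \<open>E J\<close> is a box whose product probability depends only on
  \<open>card J\<close>, and binomial coefficients count the sets of each size.\<close>

lemma emeasure_PiM_card_le:
  assumes "prob_space \<nu>" and A: "A \<in> sets \<nu>" and I: "finite I"
  shows "emeasure (\<Pi>\<^sub>M i\<in>I. \<nu>) {\<omega> \<in> space (\<Pi>\<^sub>M i\<in>I. \<nu>). card {i \<in> I. \<omega> i \<in> A} \<le> k} =
    ennreal (binomial_cdf (card I) k (measure \<nu> A))"
proof -
  interpret prob_space \<nu> by fact
  interpret product_sigma_finite "\<lambda>_. \<nu>" by standard
  define E where "E J = (\<Pi>\<^sub>E i\<in>I. if i \<in> J then A else space \<nu> - A)" for J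
  define S where "S = {J. J \<subseteq> I \<and> card J \<le> k}"
  have finS: "finite S" unfolding S_def using I by auto
  have E_iff: "\<omega> \<in> E J \<longleftrightarrow> \<omega> \<in> space (\<Pi>\<^sub>M i\<in>I. \<nu>) \<and> {i \<in> I. \<omega> i \<in> A} = J" if "J \<subseteq> I" for \<omega> J
    using that sets.sets_into_space[OF A]
    by (fastforce simp: E_def space_PiM PiE_iff split: if_splits)
  have "{\<omega> \<in> space (\<Pi>\<^sub>M i\<in>I. \<nu>). card {i \<in> I. \<omega> i \<in> A} \<le> k} = (\<Union>J\<in>S. E J)"
    by (auto simp: S_def E_iff)
  also have "emeasure (\<Pi>\<^sub>M i\<in>I. \<nu>) \<dots> = (\<Sum>J\<in>S. emeasure (\<Pi>\<^sub>M i\<in>I. \<nu>) (E J))"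
  proof (rule sum_emeasure[symmetric])
    show "E ` S \<subseteq> sets (\<Pi>\<^sub>M i\<in>I. \<nu>)" using A I by (auto simp: E_def intro!: sets_PiM_I_finite)
    show "disjoint_family_on E S" by (auto simp: disjoint_family_on_def S_def E_iff)
  qed (rule finS)
  also have "\<dots> = (\<Sum>J\<in>S. ennreal (prob A ^ card J * (1 - prob A) ^ (card I - card J)))"
  proof (rule sum.cong[OF refl])
    fix J assume "J \<in> S"
    hence J: "J \<subseteq> I" by (simp add: S_def)
    have "emeasure (\<Pi>\<^sub>M i\<in>I. \<nu>) (E J) = (\<Prod>i\<in>I. ennreal (if i \<in> J then prob A else 1 - prob A))"
      unfolding E_def using A I
      by (subst emeasure_PiM) (auto intro!: prod.cong simp: emeasure_eq_measure prob_compl)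
    also have "\<dots> = ennreal (\<Prod>i\<in>I. if i \<in> J then prob A else 1 - prob A)"
      by (rule prod_ennreal) (auto simp: prob_le_1)
    also have "(\<Prod>i\<in>I. if i \<in> J then prob A else 1 - prob A) = prob A ^ card J * (1 - prob A) ^ card (I - J)"
      using I J by (simp add: prod.If_cases Int_absorb1 Diff_eq)
    also have "card (I - J) = card I - card J" using I J by (intro card_Diff_subset) (auto intro: finite_subset)
    finally show "emeasure (\<Pi>\<^sub>M i\<in>I. \<nu>) (E J) = ennreal (prob A ^ card J * (1 - prob A) ^ (card I - card J))" .
  qed
  also have "\<dots> = ennreal (\<Sum>J\<in>S. prob A ^ card J * (1 - prob A) ^ (card I - card J))"
    by (rule sum_ennreal) (auto simp: prob_le_1)
  also have "(\<Sum>J\<in>S. prob A ^ card J * (1 - prob A) ^ (card I - card J)) =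
      (\<Sum>j\<le>k. \<Sum>J | J \<in> S \<and> card J = j. prob A ^ card J * (1 - prob A) ^ (card I - card J))"
    using finS by (intro sum.group[symmetric]) (auto simp: S_def)
  also have "\<dots> = (\<Sum>j\<le>k. \<Sum>J | J \<subseteq> I \<and> card J = j. prob A ^ j * (1 - prob A) ^ (card I - j))"
    by (intro sum.cong) (auto simp: S_def)
  also have "\<dots> = binomial_cdf (card I) k (prob A)"
    using I by (simp add: binomial_cdf_def n_subsets mult.assoc)
  finally show ?thesis .
qed

subsection \<open>Superuniformity up to a total variation error\<close>

text \<open>A real supremum dominates its members only once the family is bounded; here 1 is a
  bound.\<close>

lemma abs_diff_le_tv_dist:
  assumes "prob_space \<mu>" "prob_space \<nu>" "A \<in> sets \<mu>"
  shows "\<bar>measure \<mu> A - measure \<nu> A\<bar> \<le> tv_dist \<mu> \<nu>"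
  unfolding tv_dist_def
proof (rule cSUP_upper[OF assms(3) bdd_aboveI2])
  fix B
  show "\<bar>measure \<mu> B - measure \<nu> B\<bar> \<le> 1"
    using prob_space.prob_le_1[OF assms(1), of B] prob_space.prob_le_1[OF assms(2), of B]
      measure_nonneg[of \<mu> B] measure_nonneg[of \<nu> B] by linarith
qed

text \<open>The freedom in \<open>C\<close> has two purposes: arbitrary \<open>C\<close> tests the
  conditional expectation defining \<open>p_inf\<close>, and a well-chosen \<open>C\<close> selects
  where one kernel's tail exceeds the other's.\<close>

lemma emeasure_kernel_joint_tail:
  assumes "prob_space \<mu>" "sets \<mu> = sets M" and k: "\<kappa> \<in> M \<rightarrow>\<^sub>M prob_algebra N"
    and C: "C \<in> sets M" and [measurable]: "T \<in> borel_measurable N" "t \<in> borel_measurable M"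
  shows "emeasure (kernel_joint \<mu> N \<kappa>) {z \<in> space (M \<Otimes>\<^sub>M N). fst z \<in> C \<and> t (fst z) \<le> T (snd z)} =
    (\<integral>\<^sup>+x. ennreal (indicator C x * upper_tail (\<kappa> x) T (t x)) \<partial>\<mu>)"
proof -
  note [measurable] = C
  have "{z \<in> space (M \<Otimes>\<^sub>M N). fst z \<in> C \<and> t (fst z) \<le> T (snd z)} \<in> sets (M \<Otimes>\<^sub>M N)" by measurable
  hence B: "{z \<in> space (M \<Otimes>\<^sub>M N). fst z \<in> C \<and> t (fst z) \<le> T (snd z)} \<in> sets (\<mu> \<Otimes>\<^sub>M N)"
    using assms(2) by (simp cong: sets_pair_measure_cong)
  have k': "\<kappa> \<in> \<mu> \<rightarrow>\<^sub>M prob_algebra N" using k by (simp add: measurable_cong_sets[OF assms(2) refl])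
  show ?thesis
  proof (subst emeasure_kernel_joint[OF assms(1) k' B], rule nn_integral_cong)
    fix x assume x: "x \<in> space \<mu>"
    interpret K: prob_space "\<kappa> x" using prob_kernelD[OF k' x] by simp
    have "x \<in> space M" using x sets_eq_imp_space_eq[OF assms(2)] by simp
    hence "{y \<in> space N. (x, y) \<in> {z \<in> space (M \<Otimes>\<^sub>M N). fst z \<in> C \<and> t (fst z) \<le> T (snd z)}} =
        (if x \<in> C then {y \<in> space (\<kappa> x). t x \<le> T y} else {})"
      by (auto simp: space_pair_measure prob_kernelD[OF k' x])
    thus "emeasure (\<kappa> x) {y \<in> space N. (x, y) \<in> {z \<in> space (M \<Otimes>\<^sub>M N). fst z \<in> C \<and> t (fst z) \<le> T (snd z)}} =
        ennreal (indicator C x * upper_tail (\<kappa> x) T (t x))"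
      by (simp add: upper_tail_def K.emeasure_eq_measure)
  qed
qed

text \<open>Let \<open>s\<close> be the excess of the event \<open>p \<le> a\<close>. On it \<open>q - p\<close> is at least \<open>q - a\<close>, and among events
  of mass \<open>a + s\<close> the integral of \<open>(q - a)\<^sup>+\<close> is at least \<open>s\<^sup>2 / 2\<close>, because \<open>q\<close> is superuniform. As
  the integral of \<open>(q - p)\<^sup>+\<close> is at most \<open>\<epsilon>\<close>, this gives \<open>s \<le> sqrt (2 * \<epsilon>)\<close>.\<close>

lemma emeasure_le_of_average_gap:
  fixes p q :: "'a \<Rightarrow> real"
  assumes "prob_space \<mu>" and [measurable]: "p \<in> borel_measurable \<mu>" "q \<in> borel_measurable \<mu>"
    and sup: "\<And>u. 0 \<le> u \<Longrightarrow> emeasure \<mu> {x \<in> space \<mu>. q x \<le> u} \<le> ennreal u"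
    and gap: "(\<integral>\<^sup>+x. ennreal (q x - p x) \<partial>\<mu>) \<le> ennreal \<epsilon>" and "0 \<le> a" "0 \<le> \<epsilon>"
  shows "measure \<mu> {x \<in> space \<mu>. p x \<le> a} \<le> a + sqrt (2 * \<epsilon>)"
proof -
  interpret prob_space \<mu> by fact
  define E where "E = {x \<in> space \<mu>. p x \<le> a}"
  have [measurable]: "E \<in> sets \<mu>" unfolding E_def by measurable
  define s where "s = measure \<mu> E - a"
  have "s \<le> sqrt (2 * \<epsilon>)"
  proof (cases "s \<le> 0")
    case True
    thus ?thesis using \<open>0 \<le> \<epsilon>\<close> by (meson order_trans real_sqrt_ge_zero mult_nonneg_nonneg zero_le_numeral)
  next
    case False
    \<comment> \<open>A length written as an integral, so that the layer bound applies. On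
      \<open>E\<close>, where \<open>p x \<le> a\<close>, any loss of length below \<open>s\<close>
      caused by \<open>q x > a\<close> is covered by \<open>q x - p x\<close>.\<close>
    let ?\<phi> = "\<lambda>x. \<integral>\<^sup>+u. ennreal 1 * indicator {max a (q x)..a + s} u \<partial>lborel"
    have \<phi>: "?\<phi> x = ennreal (a + s - max a (q x))" for x
      by (auto simp: emeasure_lborel_Icc_eq ennreal_neg)
    have "ennreal s * emeasure \<mu> E = (\<integral>\<^sup>+x. ennreal s * indicator E x \<partial>\<mu>)"
      by (simp add: nn_integral_cmult)
    also have "\<dots> \<le> (\<integral>\<^sup>+x. ?\<phi> x + ennreal (q x - p x) \<partial>\<mu>)"
    proof (rule nn_integral_mono)
      fix x assume "x \<in> space \<mu>"
      show "ennreal s * indicator E x \<le> ?\<phi> x + ennreal (q x - p x)"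
      proof (cases "x \<in> E")
        case True
        hence "s \<le> max 0 (a + s - max a (q x)) + max 0 (q x - p x)"
          by (auto simp: E_def max_def)
        hence "ennreal s \<le> ennreal (max 0 (a + s - max a (q x)) + max 0 (q x - p x))"
          by (rule ennreal_leI)
        also have "\<dots> = ennreal (max 0 (a + s - max a (q x))) + ennreal (max 0 (q x - p x))"
          by (rule ennreal_plus) auto
        finally show ?thesis using True unfolding \<phi> by simp
      qed simp
    qed
    also have "\<dots> = (\<integral>\<^sup>+x. ?\<phi> x \<partial>\<mu>) + (\<integral>\<^sup>+x. ennreal (q x - p x) \<partial>\<mu>)"
      unfolding \<phi> by (rule nn_integral_add) measurable
    also have "\<dots> \<le> (\<integral>\<^sup>+u. ennreal (1 * (u + 0)) * indicator {a..a + s} u \<partial>lborel) + ennreal \<epsilon>"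
      using assms(1) sup \<open>0 \<le> a\<close> gap
      by (intro add_mono nn_integral_layer_le) auto
    also have "(\<integral>\<^sup>+u. ennreal (1 * (u + 0)) * indicator {a..a + s} u \<partial>lborel) =
        ennreal ((a + s)\<^sup>2 / 2 - a\<^sup>2 / 2)"
      using False \<open>0 \<le> a\<close>
      by (intro nn_integral_FTC_Icc) (auto intro!: derivative_eq_intros)
    also have "\<dots> + ennreal \<epsilon> = ennreal ((a + s)\<^sup>2 / 2 - a\<^sup>2 / 2 + \<epsilon>)"
      using False \<open>0 \<le> a\<close> \<open>0 \<le> \<epsilon>\<close> by (intro ennreal_plus[symmetric]) (auto intro!: power_mono)
    also have "ennreal s * emeasure \<mu> E = ennreal (s * (a + s))"
      using False \<open>0 \<le> a\<close> by (simp add: emeasure_eq_measure s_def ennreal_mult')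
    finally have "s * (a + s) \<le> (a + s)\<^sup>2 / 2 - a\<^sup>2 / 2 + \<epsilon>"
      by (rule ennreal_le_iff[THEN iffD1, rotated])
         (use False \<open>0 \<le> a\<close> \<open>0 \<le> \<epsilon>\<close> in \<open>auto intro!: add_nonneg_nonneg power_mono\<close>)
    \<comment> \<open>The products \<open>s * a\<close> cancel, leaving half the square of
      \<open>s\<close> at most \<open>\<epsilon>\<close>.\<close>
    hence "s\<^sup>2 \<le> 2 * \<epsilon>" by (simp add: power2_eq_square field_simps)
    thus ?thesis by (rule real_le_rsqrt)
  qed
  thus ?thesis by (simp add: s_def E_def)
qed

text \<open>\<open>ennreal\<close> truncates at 0, so this integrates a positive part. A single
  event attains it as a difference of the joint laws: the first coordinate lies in the set
  \<open>C\<close> where the tail of \<open>R\<close> is larger, and the second lies in the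
  tail.\<close>

lemma nn_integral_tail_gap_le:
  assumes "prob_space \<mu>" and s: "sets \<mu> = sets M" and P: "P \<in> M \<rightarrow>\<^sub>M prob_algebra N"
    and R: "R \<in> M \<rightarrow>\<^sub>M prob_algebra N"
    and [measurable]: "T \<in> borel_measurable N" "t \<in> borel_measurable M"
    and tv: "tv_dist (kernel_joint \<mu> N P) (kernel_joint \<mu> N R) \<le> \<epsilon>" and "0 \<le> \<epsilon>"
  shows "(\<integral>\<^sup>+x. ennreal (upper_tail (R x) T (t x) - upper_tail (P x) T (t x)) \<partial>\<mu>) \<le> ennreal \<epsilon>"
proof -
  let ?p = "\<lambda>x. upper_tail (P x) T (t x)" and ?q = "\<lambda>x. upper_tail (R x) T (t x)"
  let ?JP = "kernel_joint \<mu> N P" and ?JR = "kernel_joint \<mu> N R"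
  note ms = measurable_cong_sets[OF s refl]
  have [measurable]: "?p \<in> borel_measurable M" "?q \<in> borel_measurable M"
    using P R by (auto intro: upper_tail_measurable)
  have [measurable]: "?p \<in> borel_measurable \<mu>" "?q \<in> borel_measurable \<mu>"
    by (simp_all add: ms)
  have P': "P \<in> \<mu> \<rightarrow>\<^sub>M prob_algebra N" and R': "R \<in> \<mu> \<rightarrow>\<^sub>M prob_algebra N" using P R by (simp_all add: ms)
  have sp: "space \<mu> = space M" using s by (rule sets_eq_imp_space_eq)
  interpret JP: prob_space ?JP using assms(1) P' by (rule prob_space_kernel_joint)
  interpret JR: prob_space ?JR using assms(1) R' by (rule prob_space_kernel_joint)
  define C where "C = {x \<in> space M. ?p x < ?q x}"
  define A where "A = {z \<in> space (M \<Otimes>\<^sub>M N). fst z \<in> C \<and> t (fst z) \<le> T (snd z)}"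
  have C[measurable]: "C \<in> sets M" unfolding C_def by measurable
  have "A \<in> sets (M \<Otimes>\<^sub>M N)" unfolding A_def by measurable
  hence A: "A \<in> sets ?JP"
    using s by (simp add: sets_kernel_joint[OF assms(1) P'] cong: sets_pair_measure_cong)
  have C\<mu>[measurable]: "C \<in> sets \<mu>" by (simp add: s)
  have nn: "0 \<le> ?p x" "0 \<le> ?q x" for x by (simp_all add: upper_tail_def)
  \<comment> \<open>Adding the finite mass of \<open>A\<close> to both sides avoids subtraction in
    \<open>ennreal\<close>; it is cancelled at the end.\<close>
  have "(\<integral>\<^sup>+x. ennreal (?q x - ?p x) \<partial>\<mu>) + ennreal (measure ?JP A) =
      (\<integral>\<^sup>+x. ennreal (?q x - ?p x) \<partial>\<mu>) + (\<integral>\<^sup>+x. ennreal (indicator C x * ?p x) \<partial>\<mu>)"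
    using emeasure_kernel_joint_tail[OF assms(1) s P C, of T t]
    by (simp add: JP.emeasure_eq_measure A_def)
  also have "\<dots> = (\<integral>\<^sup>+x. ennreal (?q x - ?p x) + ennreal (indicator C x * ?p x) \<partial>\<mu>)"
    by (rule nn_integral_add[symmetric]) measurable
  also have "\<dots> = (\<integral>\<^sup>+x. ennreal (indicator C x * ?q x) \<partial>\<mu>)"
    by (intro nn_integral_cong)
       (auto simp: C_def sp ennreal_neg nn simp flip: ennreal_plus split: split_indicator)
  also have "\<dots> = ennreal (measure ?JR A)"
    using emeasure_kernel_joint_tail[OF assms(1) s R C, of T t]
    by (simp add: JR.emeasure_eq_measure A_def)
  also have "\<dots> \<le> ennreal (\<epsilon> + measure ?JP A)"
    using abs_diff_le_tv_dist[OF JP.prob_space_axioms JR.prob_space_axioms A] tv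
    by (intro ennreal_leI) linarith
  also have "\<dots> = ennreal \<epsilon> + ennreal (measure ?JP A)"
    using \<open>0 \<le> \<epsilon>\<close> by (simp add: ennreal_plus)
  finally show ?thesis by simp
qed

subsection \<open>Monte Carlo and exact p-values\<close>

text \<open>Sets of the \<sigma>-algebra generated by \<open>X\<close> are preimages of some
  \<open>C\<close>. The kernel formula gives the probability of \<open>X\<close> in \<open>C\<close>
  together with the tail event as the integral of \<open>p(X)\<close> over that preimage, which
  characterises the conditional expectation.\<close>

lemma p_inf_AE_eq:
  assumes "prob_space \<Omega>" and T[measurable]: "T \<in> borel_measurable M"
    and c: "has_cond_distr \<Omega> M X M X' P"
  shows "AE \<omega> in \<Omega>. p_inf \<Omega> M T X X' \<omega> = upper_tail (P (X \<omega>)) T (T (X \<omega>))"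
proof -
  interpret prob_space \<Omega> by fact
  have X[measurable]: "X \<in> \<Omega> \<rightarrow>\<^sub>M M" and X'[measurable]: "X' \<in> \<Omega> \<rightarrow>\<^sub>M M"
    and P: "P \<in> M \<rightarrow>\<^sub>M prob_algebra M"
    and d: "distr \<Omega> (M \<Otimes>\<^sub>M M) (\<lambda>\<omega>. (X \<omega>, X' \<omega>)) = kernel_joint (distr \<Omega> M X) M P"
    using c by (auto simp: has_cond_distr_def)
  define p where "p x = upper_tail (P x) T (T x)" for x
  have p[measurable]: "p \<in> borel_measurable M"
    unfolding p_def using P by (intro upper_tail_measurable) auto
  have p01: "0 \<le> p x" "x \<in> space M \<Longrightarrow> p x \<le> 1" for x
    using upper_tail_bounds(2)[OF prob_kernelD(1)[OF P]] by (auto simp: p_def upper_tail_def)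
  have XM: "\<omega> \<in> space \<Omega> \<Longrightarrow> X \<omega> \<in> space M" for \<omega> by (rule measurable_space[OF X])
  let ?F = "vimage_algebra (space \<Omega>) X M"
  have sF: "sets ?F = {X -` A \<inter> space \<Omega> | A. A \<in> sets M}"
    using XM by (intro sets_vimage_algebra2) auto
  have XF: "X \<in> ?F \<rightarrow>\<^sub>M M" using XM by (intro measurable_vimage_algebra1) auto
  have "subalgebra \<Omega> ?F" by (auto simp: subalgebra_def sF)
  then interpret finite_measure_subalgebra \<Omega> ?F by unfold_locales
  let ?E = "{\<omega> \<in> space \<Omega>. T (X' \<omega>) \<ge> T (X \<omega>)}"
  have E[measurable]: "?E \<in> sets \<Omega>" by measurable
  have "AE \<omega> in \<Omega>. real_cond_exp \<Omega> ?F (indicat_real ?E) \<omega> = p (X \<omega>)"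
  proof (rule real_cond_exp_charact)
    show "integrable \<Omega> (indicat_real ?E)" by (simp add: emeasure_eq_measure)
    show "integrable \<Omega> (\<lambda>\<omega>. p (X \<omega>))"
      by (rule integrable_const_bound[of _ 1]) (auto simp: p01 XM intro!: AE_I2)
    show "(\<lambda>\<omega>. p (X \<omega>)) \<in> borel_measurable ?F" using XF p by (rule measurable_compose)
    fix A assume "A \<in> sets ?F"
    then obtain C where C[measurable]: "C \<in> sets M" and A: "A = X -` C \<inter> space \<Omega>" by (auto simp: sF)
    let ?B = "{z \<in> space (M \<Otimes>\<^sub>M M). fst z \<in> C \<and> T (fst z) \<le> T (snd z)}"
    have B: "?B \<in> sets (M \<Otimes>\<^sub>M M)" by measurable
    have "ennreal (prob (A \<inter> ?E)) = emeasure (distr \<Omega> (M \<Otimes>\<^sub>M M) (\<lambda>\<omega>. (X \<omega>, X' \<omega>))) ?B"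
      using B measurable_space[OF X] measurable_space[OF X']
      by (auto simp: emeasure_distr emeasure_eq_measure A space_pair_measure intro!: arg_cong[of _ _ prob])
    also have "\<dots> = (\<integral>\<^sup>+x. ennreal (indicator C x * p x) \<partial>distr \<Omega> M X)"
      unfolding d p_def using P C by (intro emeasure_kernel_joint_tail prob_space_distr) auto
    also have "\<dots> = (\<integral>\<^sup>+\<omega>. ennreal (indicator C (X \<omega>) * p (X \<omega>)) \<partial>\<Omega>)"
      by (subst nn_integral_distr) auto
    also have "\<dots> = (\<integral>\<^sup>+\<omega>. ennreal (indicator A \<omega> * p (X \<omega>)) \<partial>\<Omega>)"
      by (intro nn_integral_cong) (auto simp: A split: split_indicator)
    finally have *: "(\<integral>\<^sup>+\<omega>. ennreal (indicator A \<omega> * p (X \<omega>)) \<partial>\<Omega>) = ennreal (prob (A \<inter> ?E))" ..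
    have [measurable]: "A \<in> sets \<Omega>" unfolding A by measurable
    have "(\<integral>\<omega>. indicator A \<omega> * p (X \<omega>) \<partial>\<Omega>) = prob (A \<inter> ?E)"
      using * by (subst integral_eq_nn_integral) (auto simp: p01)
    moreover have "(\<integral>\<omega>. indicat_real A \<omega> * indicator ?E \<omega> \<partial>\<Omega>) = prob (A \<inter> ?E)"
      by (simp add: indicator_inter_arith[symmetric] Int_absorb2 sets.sets_into_space)
    ultimately show "(\<integral>\<omega>\<in>A. indicat_real ?E \<omega> \<partial>\<Omega>) = (\<integral>\<omega>\<in>A. p (X \<omega>) \<partial>\<Omega>)"
      by (simp add: set_lebesgue_integral_def)
  qed
  thus ?thesis by (simp add: p_inf_def p_def)
qed

text \<open>Versions of the conditional expectation differ on null sets only, so the probability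
  depends just on the law of \<open>X\<close> and the kernel.\<close>

lemma measure_p_inf_eq:
  assumes "prob_space \<Omega>" and [measurable]: "T \<in> borel_measurable M"
    and c: "has_cond_distr \<Omega> M X M X' P"
  shows "measure \<Omega> {\<omega> \<in> space \<Omega>. p_inf \<Omega> M T X X' \<omega> \<le> \<alpha>} =
    measure (distr \<Omega> M X) {x \<in> space M. upper_tail (P x) T (T x) \<le> \<alpha>}"
proof -
  interpret prob_space \<Omega> by fact
  have X[measurable]: "X \<in> \<Omega> \<rightarrow>\<^sub>M M" and X'[measurable]: "X' \<in> \<Omega> \<rightarrow>\<^sub>M M"
    and P: "P \<in> M \<rightarrow>\<^sub>M prob_algebra M"
    using c by (auto simp: has_cond_distr_def)
  have [measurable]: "(\<lambda>x. upper_tail (P x) T (T x)) \<in> borel_measurable M"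
    using P by (intro upper_tail_measurable) auto
  have [measurable]: "p_inf \<Omega> M T X X' \<in> borel_measurable \<Omega>"
    unfolding p_inf_def by measurable
  have "measure \<Omega> {\<omega> \<in> space \<Omega>. p_inf \<Omega> M T X X' \<omega> \<le> \<alpha>} =
      measure \<Omega> {\<omega> \<in> space \<Omega>. upper_tail (P (X \<omega>)) T (T (X \<omega>)) \<le> \<alpha>}"
    using p_inf_AE_eq[OF assms] by (intro measure_eq_AE) auto
  also have "\<dots> = measure (distr \<Omega> M X) {x \<in> space M. upper_tail (P x) T (T x) \<le> \<alpha>}"
    using measurable_space[OF X] by (auto simp: measure_distr intro!: arg_cong[of _ _ prob])
  finally show ?thesis .
qed

text \<open>The same \<open>\<delta>\<close> carries over from the exact tail: given
  \<open>X\<close>, the number of exceedances is binomial, and averaging its distribution function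
  costs nothing extra.\<close>

lemma measure_p_fin_le:
  assumes "prob_space \<Omega>" and [measurable]: "T \<in> borel_measurable M"
    and P: "P \<in> M \<rightarrow>\<^sub>M prob_algebra M" and c: "cond_iid_draws \<Omega> M X P m Xs" and "1 \<le> m"
    and "0 \<le> \<delta>" and \<alpha>: "\<alpha> \<in> {0..1}"
    and le: "\<And>a. a \<in> {0..1} \<Longrightarrow>
      measure (distr \<Omega> M X) {x \<in> space M. upper_tail (P x) T (T x) \<le> a} \<le> a + \<delta>"
  shows "measure \<Omega> {\<omega> \<in> space \<Omega>. p_fin T X m Xs \<omega> \<le> \<alpha>} \<le> \<alpha> + \<delta>"
proof -
  interpret prob_space \<Omega> by fact
  let ?I = "{1..m}"
  let ?Y = "\<lambda>\<omega>. \<lambda>i\<in>?I. Xs i \<omega>"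
  let ?N = "\<Pi>\<^sub>M i\<in>?I. M"
  have c': "has_cond_distr \<Omega> M X ?N ?Y (\<lambda>x. \<Pi>\<^sub>M i\<in>?I. P x)"
    using c by (simp add: cond_iid_draws_def)
  have X[measurable]: "X \<in> \<Omega> \<rightarrow>\<^sub>M M" and Y: "?Y \<in> \<Omega> \<rightarrow>\<^sub>M ?N"
    using c' by (auto simp: has_cond_distr_def)
  interpret D: prob_space "distr \<Omega> M X" using X by (rule prob_space_distr)
  have [measurable]: "(\<lambda>x. upper_tail (P x) T (T x)) \<in> borel_measurable M"
    using P by (intro upper_tail_measurable) auto
  have m1: "0 < real m + 1" by simp
  have p_fin: "p_fin T X m Xs \<omega> \<le> \<alpha> \<longleftrightarrow> 1 + real (card {i \<in> ?I. T (X \<omega>) \<le> T (Xs i \<omega>)}) \<le> \<alpha> * (real m + 1)" for \<omega>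
  proof -
    have "(\<Sum>i=1..m. of_bool (T (Xs i \<omega>) \<ge> T (X \<omega>))) = real (card {i \<in> ?I. T (X \<omega>) \<le> T (Xs i \<omega>)})"
      by (simp add: of_bool_def sum.If_cases Int_def)
    thus ?thesis unfolding p_fin_def using m1 by (simp add: divide_le_eq)
  qed
  \<comment> \<open>Below \<open>1 / (m + 1)\<close> the event is empty, since the numerator of
    \<open>p_fin\<close> is at least 1. At \<open>\<alpha> = 1\<close> the claim is trivial, and
    excluding it secures \<open>k < m\<close>.\<close>
  consider "\<alpha> * (real m + 1) < 1" | "\<alpha> = 1" | "1 \<le> \<alpha> * (real m + 1)" "\<alpha> < 1"
    using \<alpha> by fastforce
  thus ?thesis
  proof cases
    case 1
    hence "{\<omega> \<in> space \<Omega>. p_fin T X m Xs \<omega> \<le> \<alpha>} = {}"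
      unfolding p_fin by (smt (verit) Collect_empty_eq of_nat_0_le_iff)
    thus ?thesis using \<alpha> \<open>0 \<le> \<delta>\<close> by (simp only: measure_empty) simp
  next
    case 2
    thus ?thesis using \<open>0 \<le> \<delta>\<close> prob_le_1 by (simp add: add_increasing2)
  next
    case 3
    \<comment> \<open>The largest exceedance count compatible with
      \<open>p_fin \<le> \<alpha>\<close>. The floor is at least 1, so the natural subtraction does
      not truncate.\<close>
    define k where "k = nat \<lfloor>\<alpha> * (real m + 1)\<rfloor> - 1"
    have fl: "1 \<le> \<lfloor>\<alpha> * (real m + 1)\<rfloor>" using 3 by (simp add: le_floor_iff)
    hence k1: "int k + 1 = \<lfloor>\<alpha> * (real m + 1)\<rfloor>" unfolding k_def by linarith
    have count: "1 + real c \<le> \<alpha> * (real m + 1) \<longleftrightarrow> c \<le> k" for c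
    proof -
      have "1 + real c \<le> \<alpha> * (real m + 1) \<longleftrightarrow> 1 + int c \<le> \<lfloor>\<alpha> * (real m + 1)\<rfloor>"
        by (simp add: le_floor_iff)
      thus ?thesis using k1 by linarith
    qed
    have k\<alpha>: "1 + real k \<le> \<alpha> * (real m + 1)" by (simp add: count)
    also have "\<dots> < 1 * (real m + 1)" using 3 m1 by (intro mult_strict_right_mono) auto
    finally have "k < m" by simp
    then obtain n where m: "m = Suc n" and "k \<le> n" by (cases m) auto
    \<comment> \<open>The count is a sum of 0-1 values here so that measurability is immediate;
      \<open>B_iff\<close> returns to cardinalities.\<close>
    let ?B = "{z \<in> space (M \<Otimes>\<^sub>M ?N). (\<Sum>i\<in>?I. if T (fst z) \<le> T (snd z i) then 1 else 0) \<le> real k}"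
    have B: "?B \<in> sets (M \<Otimes>\<^sub>M ?N)" by measurable
    have B_iff: "z \<in> ?B \<longleftrightarrow> z \<in> space (M \<Otimes>\<^sub>M ?N) \<and> card {i \<in> ?I. T (fst z) \<le> T (snd z i)} \<le> k" for z
      by (simp add: sum.If_cases Int_def)
    have "{\<omega> \<in> space \<Omega>. p_fin T X m Xs \<omega> \<le> \<alpha>} = {\<omega> \<in> space \<Omega>. (X \<omega>, ?Y \<omega>) \<in> ?B}"
    proof (intro Collect_cong conj_cong refl)
      fix \<omega> assume \<omega>: "\<omega> \<in> space \<Omega>"
      have "{i \<in> ?I. T (X \<omega>) \<le> T (?Y \<omega> i)} = {i \<in> ?I. T (X \<omega>) \<le> T (Xs i \<omega>)}" by auto
      moreover have "(X \<omega>, ?Y \<omega>) \<in> space (M \<Otimes>\<^sub>M ?N)"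
        using measurable_space[OF X \<omega>] measurable_space[OF Y \<omega>] by (simp add: space_pair_measure)
      ultimately show "p_fin T X m Xs \<omega> \<le> \<alpha> \<longleftrightarrow> (X \<omega>, ?Y \<omega>) \<in> ?B"
        unfolding p_fin count B_iff by (simp only: fst_conv snd_conv simp_thms)
    qed
    hence "emeasure \<Omega> {\<omega> \<in> space \<Omega>. p_fin T X m Xs \<omega> \<le> \<alpha>} =
        (\<integral>\<^sup>+x. emeasure (\<Pi>\<^sub>M i\<in>?I. P x) {y \<in> space ?N. (x, y) \<in> ?B} \<partial>distr \<Omega> M X)"
      using emeasure_has_cond_distr[OF assms(1) c' B] by simp
    also have "\<dots> = (\<integral>\<^sup>+x. ennreal (binomial_cdf (Suc n) k (upper_tail (P x) T (T x))) \<partial>distr \<Omega> M X)"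
    proof (rule nn_integral_cong)
      fix x assume "x \<in> space (distr \<Omega> M X)"
      hence x: "x \<in> space M" by simp
      note Px = prob_kernelD[OF P x]
      let ?A = "{y \<in> space (P x). T x \<le> T y}"
      have A: "?A \<in> sets (P x)" unfolding Px by measurable
      have "{y \<in> space ?N. (x, y) \<in> ?B} = {y \<in> space (\<Pi>\<^sub>M i\<in>?I. P x). card {i \<in> ?I. y i \<in> ?A} \<le> k}"
      proof (intro Collect_cong)
        fix y
        have sp: "space (\<Pi>\<^sub>M i\<in>?I. P x) = space ?N" by (simp add: space_PiM Px)
        have "{i \<in> ?I. T x \<le> T (y i)} = {i \<in> ?I. y i \<in> ?A}" if "y \<in> space ?N"
          using that by (auto simp: space_PiM Px PiE_iff)
        thus "y \<in> space ?N \<and> (x, y) \<in> ?B \<longleftrightarrow>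
            y \<in> space (\<Pi>\<^sub>M i\<in>?I. P x) \<and> card {i \<in> ?I. y i \<in> ?A} \<le> k"
          unfolding B_iff sp using x by (auto simp only: fst_conv snd_conv space_pair_measure mem_Times_iff)
      qed
      thus "emeasure (\<Pi>\<^sub>M i\<in>?I. P x) {y \<in> space ?N. (x, y) \<in> ?B} =
          ennreal (binomial_cdf (Suc n) k (upper_tail (P x) T (T x)))"
        using emeasure_PiM_card_le[OF Px(1) A, of ?I k] by (simp add: m upper_tail_def)
    qed
    also have "\<dots> \<le> ennreal ((real k + 1) / (real n + 2) + \<delta>)"
    proof (rule nn_integral_binomial_cdf_le)
      fix u :: real assume "u \<in> {0..1}"
      thus "emeasure (distr \<Omega> M X) {x \<in> space (distr \<Omega> M X). upper_tail (P x) T (T x) \<le> u} \<le> ennreal (u + \<delta>)"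
        using le by (simp add: D.emeasure_eq_measure ennreal_leI)
    qed (use \<open>0 \<le> \<delta>\<close> \<open>k \<le> n\<close> D.prob_space_axioms in
          \<open>auto intro!: upper_tail_bounds prob_kernelD(1)[OF P]\<close>)
    \<comment> \<open>With \<open>m = Suc n\<close> the Beta mean is
      \<open>(k + 1) / (m + 1)\<close>, at most \<open>\<alpha>\<close> by the choice of
      \<open>k\<close>.\<close>
    also have "\<dots> \<le> ennreal (\<alpha> + \<delta>)"
      using k\<alpha> by (intro ennreal_leI) (simp add: m divide_le_eq algebra_simps)
    finally show ?thesis
      using \<alpha> \<open>0 \<le> \<delta>\<close> by (simp add: emeasure_eq_measure flip: ennreal_plus)
  qed
qed

section \<open>Tail bounds under the two total variation conditions\<close>

text \<open>Conditional superuniformity with \<open>Y = f(X)\<close>, moved to the law of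
  \<open>X\<close>, where the tails under \<open>P x\<close> and \<open>K (f x)\<close> can be
  compared as functions of one variable.\<close>

lemma cond_tail_superuniform:
  assumes "prob_space \<Omega>" and [measurable]: "T \<in> borel_measurable M"
    and X[measurable]: "X \<in> \<Omega> \<rightarrow>\<^sub>M M" and f[measurable]: "f \<in> M \<rightarrow>\<^sub>M N"
    and c: "has_cond_distr \<Omega> N (\<lambda>\<omega>. f (X \<omega>)) M X K" and "0 \<le> a"
  shows "emeasure (distr \<Omega> M X) {x \<in> space M. upper_tail (K (f x)) T (T x) \<le> a} \<le> ennreal a"
proof -
  have K: "K \<in> N \<rightarrow>\<^sub>M prob_algebra M" using c by (simp add: has_cond_distr_def)
  have [measurable]: "(\<lambda>x. upper_tail (K (f x)) T (T x)) \<in> borel_measurable M"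
    using measurable_compose[OF f K] by (intro upper_tail_measurable) auto
  have "X -` {x \<in> space M. upper_tail (K (f x)) T (T x) \<le> a} \<inter> space \<Omega> =
      {\<omega> \<in> space \<Omega>. upper_tail (K (f (X \<omega>))) T (T (X \<omega>)) \<le> a}"
    using measurable_space[OF X] by auto
  thus ?thesis
    using emeasure_cond_upper_tail_le[OF assms(1,2) c \<open>0 \<le> a\<close>] by (simp add: emeasure_distr)
qed

text \<open>The joint distance controls the tails only on average, so superuniformity of the
  \<open>K\<close> tail is combined with the averaged gap; this is where the square root
  enters.\<close>

lemma measure_tail_le_joint_tv:
  assumes "prob_space \<Omega>" and T[measurable]: "T \<in> borel_measurable M" and P: "P \<in> M \<rightarrow>\<^sub>M prob_algebra M"
    and X[measurable]: "X \<in> \<Omega> \<rightarrow>\<^sub>M M" and f[measurable]: "f \<in> M \<rightarrow>\<^sub>M N"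
    and c: "has_cond_distr \<Omega> N (\<lambda>\<omega>. f (X \<omega>)) M X K"
    and tv: "tv_dist (kernel_joint (distr \<Omega> M X) M P) (kernel_joint (distr \<Omega> M X) M (\<lambda>x. K (f x))) \<le> \<epsilon>"
    and "0 \<le> \<epsilon>" "0 \<le> a"
  shows "measure (distr \<Omega> M X) {x \<in> space M. upper_tail (P x) T (T x) \<le> a} \<le> a + sqrt (2 * \<epsilon>)"
proof -
  have K: "(\<lambda>x. K (f x)) \<in> M \<rightarrow>\<^sub>M prob_algebra M"
    using c by (intro measurable_compose[OF f]) (simp add: has_cond_distr_def)
  have D: "prob_space (distr \<Omega> M X)" using assms(1) X by (rule prob_space.prob_space_distr)
  have [measurable]: "(\<lambda>x. upper_tail (P x) T (T x)) \<in> borel_measurable M"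
    "(\<lambda>x. upper_tail (K (f x)) T (T x)) \<in> borel_measurable M"
    using P K by (auto intro!: upper_tail_measurable)
  have "measure (distr \<Omega> M X) {x \<in> space (distr \<Omega> M X). upper_tail (P x) T (T x) \<le> a} \<le> a + sqrt (2 * \<epsilon>)"
    using cond_tail_superuniform[OF assms(1) T X f c] \<open>0 \<le> \<epsilon>\<close> \<open>0 \<le> a\<close>
    by (intro emeasure_le_of_average_gap[OF D _ _ _ nn_integral_tail_gap_le[OF D _ P K T T tv]]) auto
  thus ?thesis by simp
qed

text \<open>Here the distance controls the tail event at almost every \<open>x\<close>, so
  \<open>p \<le> a\<close> forces \<open>q \<le> a + \<epsilon>\<close> up to a null set, and
  superuniformity of \<open>q\<close> finishes.\<close>

lemma measure_tail_le_cond_tv: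
  assumes "prob_space \<Omega>" and T[measurable]: "T \<in> borel_measurable M" and P: "P \<in> M \<rightarrow>\<^sub>M prob_algebra M"
    and X[measurable]: "X \<in> \<Omega> \<rightarrow>\<^sub>M M" and f[measurable]: "f \<in> M \<rightarrow>\<^sub>M N"
    and c: "has_cond_distr \<Omega> N (\<lambda>\<omega>. f (X \<omega>)) M X K"
    and tv: "AE \<omega> in \<Omega>. tv_dist (P (X \<omega>)) (K (f (X \<omega>))) \<le> \<epsilon>"
    and "0 \<le> \<epsilon>" "0 \<le> a"
  shows "measure (distr \<Omega> M X) {x \<in> space M. upper_tail (P x) T (T x) \<le> a} \<le> a + \<epsilon>"
proof -
  interpret prob_space \<Omega> by fact
  interpret D: prob_space "distr \<Omega> M X" using X by (rule prob_space_distr)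
  have K: "(\<lambda>x. K (f x)) \<in> M \<rightarrow>\<^sub>M prob_algebra M"
    using c by (intro measurable_compose[OF f]) (simp add: has_cond_distr_def)
  have [measurable]: "(\<lambda>x. upper_tail (P x) T (T x)) \<in> borel_measurable M"
    "(\<lambda>x. upper_tail (K (f x)) T (T x)) \<in> borel_measurable M"
    using P K by (auto intro!: upper_tail_measurable)
  have gap: "upper_tail (K (f x)) T (T x) \<le> upper_tail (P x) T (T x) + tv_dist (P x) (K (f x))"
    if x: "x \<in> space M" for x
  proof -
    note Px = prob_kernelD[OF P x] and Kx = prob_kernelD[OF K x]
    have "{y \<in> space (P x). T x \<le> T y} \<in> sets (P x)" unfolding Px by measurable
    from abs_diff_le_tv_dist[OF Px(1) Kx(1) this] show ?thesis
      by (simp add: upper_tail_def Px(3) Kx(3))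
  qed
  have "emeasure (distr \<Omega> M X) {x \<in> space M. upper_tail (P x) T (T x) \<le> a} =
      emeasure \<Omega> {\<omega> \<in> space \<Omega>. upper_tail (P (X \<omega>)) T (T (X \<omega>)) \<le> a}"
    using measurable_space[OF X] by (auto simp: emeasure_distr intro!: arg_cong[of _ _ "emeasure \<Omega>"])
  also have "\<dots> \<le> emeasure \<Omega> {\<omega> \<in> space \<Omega>. upper_tail (K (f (X \<omega>))) T (T (X \<omega>)) \<le> a + \<epsilon>}"
  proof (rule emeasure_mono_AE)
    show "AE \<omega> in \<Omega>. \<omega> \<in> {\<omega> \<in> space \<Omega>. upper_tail (P (X \<omega>)) T (T (X \<omega>)) \<le> a} \<longrightarrow>
        \<omega> \<in> {\<omega> \<in> space \<Omega>. upper_tail (K (f (X \<omega>))) T (T (X \<omega>)) \<le> a + \<epsilon>}"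
      using tv by eventually_elim (use gap[OF measurable_space[OF X]] in force)
  qed measurable
  also have "\<dots> \<le> ennreal (a + \<epsilon>)"
    using assms by (intro emeasure_cond_upper_tail_le) auto
  finally show ?thesis
    using \<open>0 \<le> \<epsilon>\<close> \<open>0 \<le> a\<close> by (simp add: D.emeasure_eq_measure flip: ennreal_plus)
qed
text \<open>Both conditions enter only through a tail bound under the law of \<open>X\<close>, with
  \<open>\<delta>\<close> equal to \<open>sqrt (2 * \<epsilon>)\<close> or
  \<open>\<epsilon>\<close>; the passage to the two p-values is shared.\<close>

lemma p_value_bounds:
  assumes "prob_space \<Omega>" "T \<in> borel_measurable M" "P \<in> M \<rightarrow>\<^sub>M prob_algebra M" "0 \<le> \<delta>"
    and le: "\<And>a. a \<in> {0..1} \<Longrightarrow>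
      measure (distr \<Omega> M X) {x \<in> space M. upper_tail (P x) T (T x) \<le> a} \<le> a + \<delta>"
  shows "(\<forall>m\<ge>1. \<forall>Xs. cond_iid_draws \<Omega> M X P m Xs \<longrightarrow>
        (\<forall>\<alpha>\<in>{0..1}. measure \<Omega> {\<omega> \<in> space \<Omega>. p_fin T X m Xs \<omega> \<le> \<alpha>} \<le> \<alpha> + \<delta>)) \<and>
      (\<forall>X'. has_cond_distr \<Omega> M X M X' P \<longrightarrow>
        (\<forall>\<alpha>\<in>{0..1}. measure \<Omega> {\<omega> \<in> space \<Omega>. p_inf \<Omega> M T X X' \<omega> \<le> \<alpha>} \<le> \<alpha> + \<delta>))"
proof (intro conjI allI impI ballI)
  fix m Xs and \<alpha> :: real
  assume "1 \<le> m" "cond_iid_draws \<Omega> M X P m Xs" "\<alpha> \<in> {0..1}"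
  thus "measure \<Omega> {\<omega> \<in> space \<Omega>. p_fin T X m Xs \<omega> \<le> \<alpha>} \<le> \<alpha> + \<delta>"
    using assms by (intro measure_p_fin_le)
next
  fix X' and \<alpha> :: real
  assume c: "has_cond_distr \<Omega> M X M X' P" and "\<alpha> \<in> {0..1}"
  thus "measure \<Omega> {\<omega> \<in> space \<Omega>. p_inf \<Omega> M T X X' \<omega> \<le> \<alpha>} \<le> \<alpha> + \<delta>"
    unfolding measure_p_inf_eq[OF assms(1,2) c] by (intro le)
qed

theorem theorem2:
  fixes M Q0 :: "'a measure" and T :: "'a \<Rightarrow> real" and P :: "'a \<Rightarrow> 'a measure" and \<epsilon> :: real
    and \<Omega> :: "'w measure" and X :: "'w \<Rightarrow> 'a"
  assumes "standard_borel M"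
    and "prob_space Q0" and "sets Q0 = sets M"
    and "T \<in> borel_measurable M"
    and "P \<in> M \<rightarrow>\<^sub>M prob_algebra M"
    and "\<epsilon> \<ge> 0"
    and "prob_space \<Omega>" and "X \<in> \<Omega> \<rightarrow>\<^sub>M M" and "distr \<Omega> M X = Q0"
  shows
    "((\<exists>(N :: 'b measure) f K. f \<in> M \<rightarrow>\<^sub>M N \<and>
        has_cond_distr \<Omega> N (\<lambda>\<omega>. f (X \<omega>)) M X K \<and>
        tv_dist (kernel_joint Q0 M P) (kernel_joint Q0 M (\<lambda>x. K (f x))) \<le> \<epsilon>)
     \<longrightarrow> (\<forall>m\<ge>1. \<forall>Xs. cond_iid_draws \<Omega> M X P m Xs \<longrightarrow>
            (\<forall>\<alpha>\<in>{0..1}. measure \<Omega> {\<omega> \<in> space \<Omega>. p_fin T X m Xs \<omega> \<le> \<alpha>} \<le> \<alpha> + sqrt (2 * \<epsilon>))) \<and>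
         (\<forall>X'. has_cond_distr \<Omega> M X M X' P \<longrightarrow>
            (\<forall>\<alpha>\<in>{0..1}. measure \<Omega> {\<omega> \<in> space \<Omega>. p_inf \<Omega> M T X X' \<omega> \<le> \<alpha>} \<le> \<alpha> + sqrt (2 * \<epsilon>)))) \<and>
     ((\<exists>(N :: 'c measure) f K. f \<in> M \<rightarrow>\<^sub>M N \<and>
        has_cond_distr \<Omega> N (\<lambda>\<omega>. f (X \<omega>)) M X K \<and>
        (AE \<omega> in \<Omega>. tv_dist (P (X \<omega>)) (K (f (X \<omega>))) \<le> \<epsilon>))
     \<longrightarrow> (\<forall>m\<ge>1. \<forall>Xs. cond_iid_draws \<Omega> M X P m Xs \<longrightarrow>
            (\<forall>\<alpha>\<in>{0..1}. measure \<Omega> {\<omega> \<in> space \<Omega>. p_fin T X m Xs \<omega> \<le> \<alpha>} \<le> \<alpha> + \<epsilon>)) \<and>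
         (\<forall>X'. has_cond_distr \<Omega> M X M X' P \<longrightarrow>
            (\<forall>\<alpha>\<in>{0..1}. measure \<Omega> {\<omega> \<in> space \<Omega>. p_inf \<Omega> M T X X' \<omega> \<le> \<alpha>} \<le> \<alpha> + \<epsilon>)))"
proof (rule conjI; rule impI; elim exE conjE)
  fix N :: "'b measure" and f K
  assume f: "f \<in> M \<rightarrow>\<^sub>M N" and K: "has_cond_distr \<Omega> N (\<lambda>\<omega>. f (X \<omega>)) M X K"
    and "tv_dist (kernel_joint Q0 M P) (kernel_joint Q0 M (\<lambda>x. K (f x))) \<le> \<epsilon>"
  hence tv: "tv_dist (kernel_joint (distr \<Omega> M X) M P) (kernel_joint (distr \<Omega> M X) M (\<lambda>x. K (f x))) \<le> \<epsilon>"
    using assms(9) by simp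
  show "(\<forall>m\<ge>1. \<forall>Xs. cond_iid_draws \<Omega> M X P m Xs \<longrightarrow>
        (\<forall>\<alpha>\<in>{0..1}. measure \<Omega> {\<omega> \<in> space \<Omega>. p_fin T X m Xs \<omega> \<le> \<alpha>} \<le> \<alpha> + sqrt (2 * \<epsilon>))) \<and>
      (\<forall>X'. has_cond_distr \<Omega> M X M X' P \<longrightarrow>
        (\<forall>\<alpha>\<in>{0..1}. measure \<Omega> {\<omega> \<in> space \<Omega>. p_inf \<Omega> M T X X' \<omega> \<le> \<alpha>} \<le> \<alpha> + sqrt (2 * \<epsilon>)))"
    using assms(6)
    by (intro p_value_bounds[OF assms(7,4,5)] measure_tail_le_joint_tv[OF assms(7,4,5,8) f K tv]) auto
next
  fix N :: "'c measure" and f K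
  assume f: "f \<in> M \<rightarrow>\<^sub>M N" and K: "has_cond_distr \<Omega> N (\<lambda>\<omega>. f (X \<omega>)) M X K"
    and tv: "AE \<omega> in \<Omega>. tv_dist (P (X \<omega>)) (K (f (X \<omega>))) \<le> \<epsilon>"
  show "(\<forall>m\<ge>1. \<forall>Xs. cond_iid_draws \<Omega> M X P m Xs \<longrightarrow>
        (\<forall>\<alpha>\<in>{0..1}. measure \<Omega> {\<omega> \<in> space \<Omega>. p_fin T X m Xs \<omega> \<le> \<alpha>} \<le> \<alpha> + \<epsilon>)) \<and>
      (\<forall>X'. has_cond_distr \<Omega> M X M X' P \<longrightarrow>
        (\<forall>\<alpha>\<in>{0..1}. measure \<Omega> {\<omega> \<in> space \<Omega>. p_inf \<Omega> M T X X' \<omega> \<le> \<alpha>} \<le> \<alpha> + \<epsilon>))"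
    using assms(6)
    by (intro p_value_bounds[OF assms(7,4,5)] measure_tail_le_cond_tv[OF assms(7,4,5,8) f K tv]) auto
qed

end
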